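(* Let $f\in\mathbb{Z}[t_1^{\pm1},\dots,t_n^{\pm1}]$ be a multivariable Laurent polynomial with integer coefficients that is expressed in terms of its irreducible factors $f_1,\dots,f_k$ as $f=f_1^{n_1}\cdots f_k^{n_k}$ with $n_i\in\mathbb{N}$ for $i=1,\dots,k$. Then for every $\phi\in(\mathbb{R}^n)^*$, the Laurent norm of $\phi$ for $f$ is given by $$\|\phi\|_f=\sum_{i=1}^k n_i\,\|\phi\|_{f_i}.$$
   Context: For a nonzero Laurent polynomial $g=\sum_{\alpha\in\mathbb{Z}^n}c_\alpha \mathbf{t}^\alpha\in\mathbb{Z}[t_1^{\pm1},\dots,t_n^{\pm1}]$, where $\mathbf{t}^\alpha=t_1^{\alpha_1}\cdots t_n^{\alpha_n}$, let $\operatorname{supp}(g)=\{\alpha\in\mathbb{Z}^n: c_\alpha\neq0\}$ (a finite set). The Laurent norm for $g$ is the function on $(\mathbb{R}^n)^*=\operatorname{Hom}_{\mathbb{R}}(\mathbb{R}^n,\mathbb{R})$ given by $\|\phi\|_g=\sup_{\alpha,\beta\in\operatorname{supp}(g)}\phi(\alpha-\beta)$, where exponents are viewed in $\mathbb{Z}^n\subset\mathbb{R}^n$. *)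

theory Defs
  imports "HOL-Analysis.Analysis" "HOL-Library.Poly_Mapping"
begin

(* The Laurent polynomial ring Z[t_1^{+-1},...,t_n^{+-1}], n = CARD('n), as the group ring Z[Z^n]:
   finitely supported maps Z^n => Z with convolution product. The monomial c t^\<alpha> is
   Poly_Mapping.single \<alpha> c; only the additive structure of int^'n enters the product. *)
type_synonym 'n laurent = "(int ^ 'n) \<Rightarrow>\<^sub>0 int"

definition real_exponent :: "int ^ 'n \<Rightarrow> real ^ 'n" where
  "real_exponent \<alpha> = (\<chi> i. of_int (\<alpha> $ i))"

definition laurent_supp :: "'n::finite laurent \<Rightarrow> (int ^ 'n) set" where
  "laurent_supp g = {\<alpha>. Poly_Mapping.lookup g \<alpha> \<noteq> 0}"

(* Meaningful for g \<noteq> 0 and linear \<phi>; for g = 0 this is the supremum of the empty set,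
   an unspecified real. *)
definition laurent_norm :: "'n::finite laurent \<Rightarrow> (real ^ 'n \<Rightarrow> real) \<Rightarrow> real" where
  "laurent_norm g \<phi> =
     (SUP (\<alpha>, \<beta>) \<in> laurent_supp g \<times> laurent_supp g. \<phi> (real_exponent (\<alpha> - \<beta>)))"

end

theory Submission
  imports Defs
begin

text \<open>The norm splits as a maximum of \<open>\<phi>\<close> over the support plus a maximum of \<open>- \<phi>\<close>, so
  it suffices that the maximum over the support is additive under products. Only cancellation among
  the top terms could spoil this, and a top term that cannot cancel is found without ordering
  the monomials: among all sums \<open>a + b\<close> of exponents in the two top faces take one of maximal
  Euclidean length. If \<open>a + b = a' + b'\<close>, this point is the midpoint of \<open>a + b'\<close> and
  \<open>a' + b\<close>, so by strict convexity of the ball the two representations coincide.\<close>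

text \<open>In the convolution sum at \<open>a + b\<close>, any other pair of exponents with this
  sum has a vanishing coefficient in \<open>f\<close> or in \<open>g\<close>, so a single term
  survives and nothing can cancel it.\<close>

lemma lookup_mult_unique_sum:
  fixes f g :: "'a::monoid_add \<Rightarrow>\<^sub>0 'b::semiring_0"
  assumes a: "a \<in> Poly_Mapping.keys f" and b: "b \<in> Poly_Mapping.keys g"
    and unique: "\<And>a' b'. a' \<in> Poly_Mapping.keys f \<Longrightarrow> b' \<in> Poly_Mapping.keys g \<Longrightarrow>
      a' + b' = a + b \<Longrightarrow> a' = a \<and> b' = b"
  shows "Poly_Mapping.lookup (f * g) (a + b) = Poly_Mapping.lookup f a * Poly_Mapping.lookup g b"
proof -
  have "Poly_Mapping.lookup f l * (\<Sum>q. Poly_Mapping.lookup g q when a + b = l + q) =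
      (Poly_Mapping.lookup f a * Poly_Mapping.lookup g b when l = a)" for l
  proof (cases "l \<in> Poly_Mapping.keys f")
    case True
    \<comment> \<open>The summand is put into the form \<open>... when q = b\<close>, so that the
      inner sum collapses; the condition \<open>l = a\<close> is kept inside to collapse the outer
      sum in the same way.\<close>
    have "(Poly_Mapping.lookup g q when a + b = l + q) =
        ((Poly_Mapping.lookup g b when l = a) when q = b)" for q
    proof (cases "l = a \<and> q = b")
      case False
      then have "Poly_Mapping.lookup g q = 0" if "a + b = l + q"
        using unique[OF True, of q] that by (metis in_keys_iff)
      with False show ?thesis
        by (auto simp: when_def)
    qed simp
    then have "(\<Sum>q. Poly_Mapping.lookup g q when a + b = l + q) =
        (\<Sum>q. (Poly_Mapping.lookup g b when l = a) when q = b)"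
      by (simp only:)
    then have "(\<Sum>q. Poly_Mapping.lookup g q when a + b = l + q) = (Poly_Mapping.lookup g b when l = a)"
      by (simp only: Sum_any_when_equal)
    then show ?thesis
      by (simp only: mult_when cong: when_cong)
  next
    case False
    then have "Poly_Mapping.lookup f l = 0" "l \<noteq> a"
      using a by (auto simp: in_keys_iff)
    then show ?thesis
      by (simp only: mult_zero_left when_simps)
  qed
  then show ?thesis
    by (simp only: lookup_mult Sum_any_when_equal)
qed

lemma finite_sets_unique_sum:
  fixes A B :: "'a::real_inner set"
  assumes "finite A" "finite B" "A \<noteq> {}" "B \<noteq> {}"
  obtains a b where "a \<in> A" "b \<in> B"
    "\<And>a' b'. a' \<in> A \<Longrightarrow> b' \<in> B \<Longrightarrow> a' + b' = a + b \<Longrightarrow> a' = a \<and> b' = b"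
proof -
  let ?N = "(\<lambda>(a, b). norm (a + b)) ` (A \<times> B)"
  have fin: "finite ?N" and "?N \<noteq> {}"
    using assms by auto
  then have "Max ?N \<in> ?N"
    by (rule Max_in)
  then obtain a b where ab: "a \<in> A" "b \<in> B" and "norm (a + b) = Max ?N"
    by auto
  then have le: "norm (x + y) \<le> norm (a + b)" if "x \<in> A" "y \<in> B" for x y
    using that Max_ge[OF fin, of "norm (x + y)"] by force
  have "a' = a \<and> b' = b" if a': "a' \<in> A" and b': "b' \<in> B" and eq: "a' + b' = a + b" for a' b'
  proof -
    define d where "d = a - a'"
    have d: "a + b' = (a + b) + d" "a' + b = (a + b) - d"
      using eq by (auto simp: d_def algebra_simps)
    have "(norm ((a + b) + d))\<^sup>2 \<le> (norm (a + b))\<^sup>2" "(norm ((a + b) - d))\<^sup>2 \<le> (norm (a + b))\<^sup>2"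
      using le[OF ab(1) b'] le[OF a' ab(2)] unfolding d by (simp_all add: power_mono)
    \<comment> \<open>The parallelogram law makes strict convexity quantitative: both squares on the
      left are at most that of the midpoint, which leaves no room for \<open>d\<close>.\<close>
    moreover have "(norm ((a + b) + d))\<^sup>2 + (norm ((a + b) - d))\<^sup>2 = 2 * (norm (a + b))\<^sup>2 + 2 * (norm d)\<^sup>2"
      unfolding power2_norm_eq_inner by (simp add: inner_simps inner_commute)
    ultimately have "(norm d)\<^sup>2 \<le> 0"
      by linarith
    then have "d = 0"
      by simp
    then show ?thesis
      using eq by (simp add: d_def)
  qed
  with ab show thesis
    using that by blast
qed

lemma real_exponent_add: "real_exponent (\<alpha> + \<beta>) = real_exponent \<alpha> + real_exponent \<beta>"
  by (simp add: real_exponent_def vec_eq_iff)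

lemma real_exponent_diff: "real_exponent (\<alpha> - \<beta>) = real_exponent \<alpha> - real_exponent \<beta>"
  by (simp add: real_exponent_def vec_eq_iff)

lemma inj_real_exponent: "inj real_exponent"
  by (auto simp: inj_def real_exponent_def vec_eq_iff)

lemma laurent_supp_eq_keys: "laurent_supp g = Poly_Mapping.keys g"
  by (auto simp: laurent_supp_def in_keys_iff)

text \<open>For linear \<open>\<phi>\<close> and nonzero \<open>g\<close> this is the support
  function of the Newton polytope of \<open>g\<close>, since a linear function on a convex hull of
  finitely many points is maximal at one of them.\<close>

definition newton_support :: "(real ^ 'n \<Rightarrow> real) \<Rightarrow> 'n::finite laurent \<Rightarrow> real" where
  "newton_support \<phi> g = (MAX \<alpha>\<in>Poly_Mapping.keys g. \<phi> (real_exponent \<alpha>))"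

lemma newton_support_ge: "\<alpha> \<in> Poly_Mapping.keys g \<Longrightarrow> \<phi> (real_exponent \<alpha>) \<le> newton_support \<phi> g"
  unfolding newton_support_def by (rule Max_ge) auto

lemma newton_support_attained:
  assumes "g \<noteq> 0"
  obtains \<alpha> where "\<alpha> \<in> Poly_Mapping.keys g" "\<phi> (real_exponent \<alpha>) = newton_support \<phi> g"
proof -
  have "newton_support \<phi> g \<in> (\<lambda>\<alpha>. \<phi> (real_exponent \<alpha>)) ` Poly_Mapping.keys g"
    unfolding newton_support_def using assms by (intro Max_in) auto
  then show thesis
    using that by auto
qed

text \<open>The upper bound holds because every exponent of the product is a sum of exponents of the
  factors; the lower bound comes from a term in the top faces that cannot cancel. The same term
  shows that the product is nonzero.\<close>

lemma newton_support_mult: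
  fixes f g :: "'n::finite laurent"
  assumes "linear \<phi>" "f \<noteq> 0" "g \<noteq> 0"
  shows "f * g \<noteq> 0 \<and> newton_support \<phi> (f * g) = newton_support \<phi> f + newton_support \<phi> g"
proof -
  define face where "face h = {\<alpha> \<in> Poly_Mapping.keys h. \<phi> (real_exponent \<alpha>) = newton_support \<phi> h}"
    for h :: "'n laurent"
  have face: "finite (real_exponent ` face h)" "h \<noteq> 0 \<Longrightarrow> real_exponent ` face h \<noteq> {}" for h
    using newton_support_attained[of h \<phi>] by (auto simp: face_def)
  \<comment> \<open>The faces are moved into \<open>real ^ 'n\<close>, where Euclidean length is
    available; injectivity of \<open>real_exponent\<close> later carries uniqueness back to integer
    exponents.\<close>
  obtain x y where xy: "x \<in> real_exponent ` face f" "y \<in> real_exponent ` face g"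
    and unique: "\<And>x' y'. x' \<in> real_exponent ` face f \<Longrightarrow> y' \<in> real_exponent ` face g \<Longrightarrow>
      x' + y' = x + y \<Longrightarrow> x' = x \<and> y' = y"
    using finite_sets_unique_sum[OF face(1) face(1) face(2) face(2)] assms(2,3) by metis
  obtain a b where a: "a \<in> face f" "x = real_exponent a" and b: "b \<in> face g" "y = real_exponent b"
    using xy by auto
  have add: "\<phi> (real_exponent (\<alpha> + \<beta>)) = \<phi> (real_exponent \<alpha>) + \<phi> (real_exponent \<beta>)" for \<alpha> \<beta>
    using assms(1) by (simp add: real_exponent_add linear_add)
  have "a' = a \<and> b' = b"
    if a': "a' \<in> Poly_Mapping.keys f" and b': "b' \<in> Poly_Mapping.keys g" and eq: "a' + b' = a + b"
    for a' b'
  proof -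
    \<comment> \<open>Uniqueness is so far known only within the faces. A sum of two values that
      equals the sum of their maxima forces each value to be maximal, so competing pairs lie in the
      faces as well.\<close>
    have "\<phi> (real_exponent a') + \<phi> (real_exponent b') = newton_support \<phi> f + newton_support \<phi> g"
      using a b add[of a' b'] add[of a b] eq by (simp add: face_def)
    then have "a' \<in> face f" "b' \<in> face g"
      using a' b' newton_support_ge[OF a', of \<phi>] newton_support_ge[OF b', of \<phi>] by (auto simp: face_def)
    moreover have "real_exponent a' + real_exponent b' = x + y"
      using a b eq by (metis real_exponent_add)
    ultimately have "real_exponent a' = x \<and> real_exponent b' = y"
      using unique by blast
    then show ?thesis
      using a b by (simp add: inj_eq[OF inj_real_exponent])
  qed
  then have "Poly_Mapping.lookup (f * g) (a + b) = Poly_Mapping.lookup f a * Poly_Mapping.lookup g b"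
    using a b by (intro lookup_mult_unique_sum) (auto simp: face_def)
  \<comment> \<open>The coefficient is a product of two nonzero integers.\<close>
  then have key: "a + b \<in> Poly_Mapping.keys (f * g)"
    using a b by (simp add: face_def in_keys_iff)
  then have nz: "f * g \<noteq> 0"
    by auto
  have "newton_support \<phi> f + newton_support \<phi> g \<le> newton_support \<phi> (f * g)"
    using newton_support_ge[OF key, of \<phi>] a b add by (simp add: face_def)
  moreover obtain c where c: "c \<in> Poly_Mapping.keys (f * g)"
    "\<phi> (real_exponent c) = newton_support \<phi> (f * g)"
    using newton_support_attained[OF nz] .
  then obtain a' b' where "a' \<in> Poly_Mapping.keys f" "b' \<in> Poly_Mapping.keys g" "c = a' + b'"
    using keys_mult[of f g] by auto
  then have "newton_support \<phi> (f * g) \<le> newton_support \<phi> f + newton_support \<phi> g"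
    using c(2) add newton_support_ge[of a' f \<phi>] newton_support_ge[of b' g \<phi>] by simp
  ultimately show ?thesis
    using nz by simp
qed

text \<open>The two exponents vary independently over the support, so the supremum is attained by
  pairing a maximizer of \<open>\<phi>\<close> with a minimizer.\<close>

lemma laurent_norm_eq_newton_support:
  fixes g :: "'n::finite laurent"
  assumes "linear \<phi>" "g \<noteq> 0"
  shows "laurent_norm g \<phi> = newton_support \<phi> g + newton_support (\<lambda>x. - \<phi> x) g"
proof -
  have diff: "\<phi> (real_exponent (\<alpha> - \<beta>)) = \<phi> (real_exponent \<alpha>) + - \<phi> (real_exponent \<beta>)" for \<alpha> \<beta>
    using assms(1) by (simp add: real_exponent_diff linear_diff)
  obtain a where a: "a \<in> Poly_Mapping.keys g" "\<phi> (real_exponent a) = newton_support \<phi> g"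
    using newton_support_attained[OF assms(2)] .
  obtain b where b: "b \<in> Poly_Mapping.keys g"
      "- \<phi> (real_exponent b) = newton_support (\<lambda>x. - \<phi> x) g"
    using newton_support_attained[OF assms(2), of "\<lambda>x. - \<phi> x"] .
  have "newton_support \<phi> g + newton_support (\<lambda>x. - \<phi> x) g = \<phi> (real_exponent (a - b))"
    using a b diff by simp
  then have "newton_support \<phi> g + newton_support (\<lambda>x. - \<phi> x) g
      \<in> (\<lambda>(\<alpha>, \<beta>). \<phi> (real_exponent (\<alpha> - \<beta>))) ` (laurent_supp g \<times> laurent_supp g)"
    using a b by (force simp: laurent_supp_eq_keys)
  moreover have "\<phi> (real_exponent (\<alpha> - \<beta>)) \<le> newton_support \<phi> g + newton_support (\<lambda>x. - \<phi> x) g"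
    if "\<alpha> \<in> Poly_Mapping.keys g" "\<beta> \<in> Poly_Mapping.keys g" for \<alpha> \<beta>
    unfolding diff using newton_support_ge[OF that(1), of \<phi>]
      newton_support_ge[OF that(2), of "\<lambda>x. - \<phi> x"] by (rule add_mono)
  ultimately show ?thesis
    unfolding laurent_norm_def by (intro cSup_eq_maximum) (auto simp: laurent_supp_eq_keys)
qed

lemma laurent_norm_mult:
  assumes "linear \<phi>" "f \<noteq> 0" "g \<noteq> 0"
  shows "f * g \<noteq> 0 \<and> laurent_norm (f * g) \<phi> = laurent_norm f \<phi> + laurent_norm g \<phi>"
  using newton_support_mult[OF assms] newton_support_mult[OF linear_compose_neg[OF assms(1)] assms(2,3)]
  by (simp add: assms laurent_norm_eq_newton_support)

lemma laurent_norm_one: "linear \<phi> \<Longrightarrow> laurent_norm 1 \<phi> = 0"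
  \<comment> \<open>Since \<open>1 * 1 = 1\<close>, the norm of \<open>1\<close> equals twice
    itself.\<close>
  using laurent_norm_mult[of \<phi> 1 1] by simp

text \<open>Nonvanishing is carried through the induction because additivity of the norm requires
  both factors to be nonzero.\<close>

lemma laurent_norm_power:
  assumes "linear \<phi>" "g \<noteq> 0"
  shows "g ^ n \<noteq> 0 \<and> laurent_norm (g ^ n) \<phi> = real n * laurent_norm g \<phi>"
proof (induction n)
  case 0
  show ?case
    using assms(1) by (simp add: laurent_norm_one)
next
  case (Suc n)
  then show ?case
    using laurent_norm_mult[OF assms, of "g ^ n"] by (simp add: algebra_simps)
qed

lemma laurent_norm_prod:
  assumes "linear \<phi>" "finite I" "\<And>i. i \<in> I \<Longrightarrow> G i \<noteq> 0"
  shows "prod G I \<noteq> 0 \<and> laurent_norm (prod G I) \<phi> = (\<Sum>i\<in>I. laurent_norm (G i) \<phi>)"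
  using assms(2,3)
proof (induction I rule: finite_induct)
  case empty
  show ?case
    using assms(1) by (simp add: laurent_norm_one)
next
  case (insert i I)
  then show ?case
    using laurent_norm_mult[OF assms(1), of "G i" "prod G I"] by simp
qed

theorem theorem1p4:
  fixes f :: "'n::finite laurent"
    and k :: nat
    and F :: "nat \<Rightarrow> 'n laurent"
    and m :: "nat \<Rightarrow> nat"
  assumes irred: "\<forall>i\<in>{1..k}. irreducible (F i)"
    and factorization: "f = (\<Prod>i=1..k. F i ^ m i)"
  shows "\<forall>\<phi> :: real ^ 'n \<Rightarrow> real. linear \<phi> \<longrightarrow>
           laurent_norm f \<phi> = (\<Sum>i=1..k. real (m i) * laurent_norm (F i) \<phi>)"
proof (intro allI impI)
  fix \<phi> :: "real ^ 'n \<Rightarrow> real"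
  assume \<phi>: "linear \<phi>"
  have power: "F i ^ m i \<noteq> 0 \<and> laurent_norm (F i ^ m i) \<phi> = real (m i) * laurent_norm (F i) \<phi>"
    if "i \<in> {1..k}" for i
    \<comment> \<open>Irreducible elements are nonzero by definition, as the power rule
      requires.\<close>
    using irred that by (intro laurent_norm_power[OF \<phi>]) (auto simp: irreducible_def)
  then have "laurent_norm f \<phi> = (\<Sum>i=1..k. laurent_norm (F i ^ m i) \<phi>)"
    unfolding factorization using laurent_norm_prod[OF \<phi>, of "{1..k}" "\<lambda>i. F i ^ m i"] by simp
  then show "laurent_norm f \<phi> = (\<Sum>i=1..k. real (m i) * laurent_norm (F i) \<phi>)"
    using power by simp
qed

end
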